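(* Let $t\ge 3$ be fixed. For every sufficiently large $q$ there exist a set $R\subseteq\{0,1,\ldots,q-1\}$ with $|R|=t$ and rank $r=r(R)$, and an $R$-solution-free set $M\subseteq\{0,1,\ldots,\lfloor (q-1)/r\rfloor\}$, such that, as $q\to\infty$, $r=q^{o(1)}$ and $|M|\ge q^{1-o(1)}$.
   Context: For a sequence $U=(u_1,\ldots,u_k)$ of $k$ mutually distinct integers, $\mathcal L(U)$ denotes the linear equation $(u_1-u_k)x_1+(u_2-u_1)x_2+\cdots+(u_k-u_{k-1})x_k=0$. A set $M$ of integers is solution-free of a linear equation in $k$ unknowns if there is no solution $(x_1,\ldots,x_k)\in M^k$ other than the trivial ones with $x_1=\cdots=x_k$. For a finite set $R$ of integers, a $k$-permutation sequence of $R$ is a sequence of $k$ mutually distinct elements of $R$. A set $M$ is $R$-solution-free if for every $k$ with $3\le k\le |R|$ and every $k$-permutation sequence $U$ of $R$, $M$ is solution-free of $\mathcal L(U)$. The rank $r(R)$ of $R$ is $\max R-\min R$. *)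

theory Defs
  imports Complex_Main "HOL-Library.Landau_Symbols"
begin

text \<open>
  A homogeneous linear equation in \<open>k\<close> unknowns is represented by the list of its
  \<open>k\<close> coefficients, and an assignment to the unknowns by a list of the same length.
\<close>

definition is_solution :: "int list \<Rightarrow> int list \<Rightarrow> bool" where
  "is_solution as xs \<longleftrightarrow>
     length xs = length as \<and> (\<Sum>i<length as. as ! i * xs ! i) = 0"

definition trivial_assignment :: "int list \<Rightarrow> bool" where
  "trivial_assignment xs \<longleftrightarrow> (\<forall>i<length xs. \<forall>j<length xs. xs ! i = xs ! j)"

definition solution_free :: "int list \<Rightarrow> int set \<Rightarrow> bool" where
  "solution_free as M \<longleftrightarrow>
     (\<forall>xs. set xs \<subseteq> M \<and> is_solution as xs \<longrightarrow> trivial_assignment xs)"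

text \<open>
  The coefficients of \<open>\<L>(U)\<close> for \<open>U = (u\<^sub>1, \<dots>, u\<^sub>k)\<close> are
  \<open>u\<^sub>1 - u\<^sub>k, u\<^sub>2 - u\<^sub>1, \<dots>, u\<^sub>k - u\<^bsub>k-1\<^esub>\<close>; list positions start at \<open>0\<close>.
\<close>

definition cyclic_equation :: "int list \<Rightarrow> int list" where
  "cyclic_equation U =
     map (\<lambda>i. if i = 0 then U ! 0 - U ! (length U - 1) else U ! i - U ! (i - 1))
       [0..<length U]"

definition permutation_sequence :: "nat \<Rightarrow> int set \<Rightarrow> int list \<Rightarrow> bool" where
  "permutation_sequence k R U \<longleftrightarrow> length U = k \<and> distinct U \<and> set U \<subseteq> R"

definition set_solution_free :: "int set \<Rightarrow> int set \<Rightarrow> bool" where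
  "set_solution_free R M \<longleftrightarrow>
     (\<forall>k U. 3 \<le> k \<and> k \<le> card R \<and> permutation_sequence k R U \<longrightarrow>
        solution_free (cyclic_equation U) M)"

text \<open>Meaningful only for finite nonempty sets.\<close>

definition set_rank :: "int set \<Rightarrow> int" where
  "set_rank R = Max R - Min R"

end

theory Submission
  imports Defs "HOL-Number_Theory.Cong" "HOL-Real_Asymp.Real_Asymp"
begin

text \<open>
  By the Chinese remainder theorem one can choose \<open>R = {r\<^sub>0, \<dots>, r\<^bsub>t-1\<^esub>}\<close> and, for every ordering
  \<open>w\<close> of some of the indices, a modulus \<open>p\<^sub>w\<close> such that \<open>r\<close> takes the values \<open>0, 1, 2, \<dots>\<close>
  along \<open>w\<close> modulo \<open>p\<^sub>w\<close>. Modulo its own \<open>p\<^sub>w\<close> each equation \<open>\<L>(U)\<close> then becomes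
  \<open>x\<^sub>2 + \<dots> + x\<^sub>k = (k - 1) x\<^sub>1\<close>, for which Behrend's sphere construction gives a dense set \<open>Y\<close>
  of digits without nontrivial solutions. The integers whose base-\<open>p\<^sub>w\<close> digits all lie in \<open>Y\<close>
  are solution-free of \<open>\<L>(U)\<close>: the lowest digits of a solution agree, and after removing them the
  higher digits solve the same equation. The equations are invariant under translation, so by
  averaging one can intersect suitable translates of these finitely many sets and stay dense.
  For each exponent loss a single \<open>R\<close> works for all large \<open>q\<close>; letting the loss tend to \<open>0\<close>
  slowly with \<open>q\<close> gives the claim.
\<close>

section \<open>Integers with restricted digits\<close>

text \<open>There are exactly \<open>m\<close> digits, lowest first. Since \<open>0\<close> need not
  lie in \<open>Y\<close>, the length has to be a parameter; peeling off the lowest digit is what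
  the later inductions do.\<close>

fun expansions :: "int \<Rightarrow> int set \<Rightarrow> nat \<Rightarrow> int set" where
  "expansions p Y 0 = {0}"
| "expansions p Y (Suc m) = (\<lambda>(y, z). y + p * z) ` (Y \<times> expansions p Y m)"

lemma expansions_Suc_iff:
  assumes "Y \<subseteq> {0..<p}"
  shows "x \<in> expansions p Y (Suc m) \<longleftrightarrow> x mod p \<in> Y \<and> x div p \<in> expansions p Y m"
proof
  assume "x \<in> expansions p Y (Suc m)"
  then obtain y z where yz: "x = y + p * z" "y \<in> Y" "z \<in> expansions p Y m" by auto
  have "0 \<le> y" "y < p" using yz(2) assms by auto
  then have "x mod p = y" "x div p = z" using yz(1) by simp_all
  then show "x mod p \<in> Y \<and> x div p \<in> expansions p Y m" using yz by simp
next
  assume "x mod p \<in> Y \<and> x div p \<in> expansions p Y m"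
  moreover have "x = x mod p + p * (x div p)" by simp
  ultimately show "x \<in> expansions p Y (Suc m)"
    unfolding expansions.simps by (intro image_eqI[of _ _ "(x mod p, x div p)"]) auto
qed

lemma expansions_bound:
  assumes "Y \<subseteq> {0..<p}"
  shows "expansions p Y m \<subseteq> {0..<p ^ m}"
proof (induction m)
  case (Suc m)
  show ?case
  proof
    fix x assume "x \<in> expansions p Y (Suc m)"
    then obtain y z where yz: "x = y + p * z" "y \<in> Y" "z \<in> expansions p Y m" by auto
    have y: "0 \<le> y" "y < p" using yz(2) assms by auto
    have z: "0 \<le> z" "z + 1 \<le> p ^ m" using yz(3) Suc by auto
    have "p * (z + 1) \<le> p * p ^ m" using y z by (intro mult_left_mono) auto
    then have "x < p ^ Suc m" using yz(1) y by (simp add: algebra_simps)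
    moreover have "0 \<le> x" using yz(1) y z by simp
    ultimately show "x \<in> {0..<p ^ Suc m}" by simp
  qed
qed simp

lemma card_expansions:
  assumes "Y \<subseteq> {0..<p}"
  shows "card (expansions p Y m) = card Y ^ m"
proof (induction m)
  case (Suc m)
  have "inj_on (\<lambda>(y, z). y + p * z) (Y \<times> expansions p Y m)"
  proof (rule inj_onI, clarify)
    fix a b c d assume h: "a \<in> Y" "c \<in> Y" "a + p * b = c + p * d"
    then have "0 \<le> a" "a < p" "0 \<le> c" "c < p" using assms by auto
    then have "(a + p * b) mod p = a" "(a + p * b) div p = b"
      "(c + p * d) mod p = c" "(c + p * d) div p = d" by simp_all
    then show "a = c \<and> b = d" unfolding h(3) by simp
  qed
  then show ?case using Suc by (simp add: card_image card_cartesian_product)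
qed simp

section \<open>Behrend's sphere construction\<close>

text \<open>The squared Euclidean norm of the vector of the \<open>n\<close> lowest
  base-\<open>B\<close> digits; its level sets are Behrend's spheres.\<close>

fun digit_sq :: "int \<Rightarrow> nat \<Rightarrow> int \<Rightarrow> int" where
  "digit_sq B 0 x = 0"
| "digit_sq B (Suc n) x = (x mod B)\<^sup>2 + digit_sq B n (x div B)"

text \<open>The variance identity about the mean \<open>c\<close>: it measures how far the convexity
  of squaring is from equality.\<close>

lemma sum_squares_deviation:
  fixes y :: "nat \<Rightarrow> int"
  assumes "(\<Sum>i=1..k. y i) = int k * c"
  shows "(\<Sum>i=1..k. (y i)\<^sup>2) = int k * c\<^sup>2 + (\<Sum>i=1..k. (y i - c)\<^sup>2)"
proof -
  have "(\<Sum>i=1..k. (y i - c)\<^sup>2) = (\<Sum>i=1..k. (y i)\<^sup>2 - 2 * c * y i + c\<^sup>2)"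
    by (intro sum.cong) (auto simp: power2_eq_square algebra_simps)
  also have "\<dots> = (\<Sum>i=1..k. (y i)\<^sup>2) - 2 * c * (\<Sum>i=1..k. y i) + int k * c\<^sup>2"
    by (simp add: sum.distrib sum_subtractf sum_distrib_left)
  finally show ?thesis using assms by (simp add: power2_eq_square)
qed

text \<open>No carries: for \<open>k > 0\<close> both sides lie between \<open>0\<close> and
  \<open>k * (d - 1) < p\<close>, so a difference divisible by \<open>p\<close> vanishes.\<close>

lemma average_digits:
  fixes y :: "nat \<Rightarrow> int"
  assumes y: "\<And>i. i \<le> k \<Longrightarrow> y i \<in> {0..<d}" and kd: "int k * d \<le> p" and p: "p > 0"
    and dvd: "p dvd (\<Sum>i=1..k. y i) - int k * y 0"
  shows "(\<Sum>i=1..k. y i) = int k * y 0"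
proof (cases "k = 0")
  case False
  have y0: "0 \<le> y 0" "y 0 + 1 \<le> d" using y[of 0] by auto
  have "(\<Sum>i=1..k. y i) \<le> (\<Sum>i=1..k. d - 1)" using y by (intro sum_mono) force
  then have 1: "(\<Sum>i=1..k. y i) \<le> int k * (d - 1)" by simp
  have 2: "0 \<le> (\<Sum>i=1..k. y i)" using y by (intro sum_nonneg) force
  have 3: "0 \<le> int k * y 0" "int k * y 0 \<le> int k * (d - 1)"
    using y0 by (auto intro: mult_left_mono)
  have "int k * (d - 1) < p" using kd False by (simp add: algebra_simps)
  then have "\<bar>(\<Sum>i=1..k. y i) - int k * y 0\<bar> < p" using 1 2 3 by linarith
  then have "(\<Sum>i=1..k. y i) - int k * y 0 = 0"
    using dvd p zdvd_not_zless[of "\<bar>(\<Sum>i=1..k. y i) - int k * y 0\<bar>" p] by (metis dvd_abs_iff zero_less_abs_iff)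
  then show ?thesis by simp
qed simp

text \<open>Without carries the averaging equation holds in each digit position, and each position
  contributes a nonnegative variance. The equality case needs the inequality for the higher digits,
  so both are proved in one induction.\<close>

lemma digit_sq_convex:
  fixes x :: "nat \<Rightarrow> int"
  assumes "int k * d \<le> B" "0 < d" "d \<le> B"
    and "\<And>i. i \<le> k \<Longrightarrow> x i \<in> expansions B {0..<d} n"
    and "(\<Sum>i=1..k. x i) = int k * x 0"
  shows "int k * digit_sq B n (x 0) \<le> (\<Sum>i=1..k. digit_sq B n (x i)) \<and>
    ((\<Sum>i=1..k. digit_sq B n (x i)) = int k * digit_sq B n (x 0) \<longrightarrow> (\<forall>i\<le>k. x i = x 0))"
  using assms(4,5)
proof (induction n arbitrary: x)
  case (Suc n)
  define y z where "y = (\<lambda>i. x i mod B)" and "z = (\<lambda>i. x i div B)"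
  have sub: "{0..<d} \<subseteq> {0..<B}" using assms(3) by auto
  have yz: "y i \<in> {0..<d}" "z i \<in> expansions B {0..<d} n" if "i \<le> k" for i
    using Suc.prems(1)[OF that] unfolding expansions_Suc_iff[OF sub] y_def z_def by auto
  have x: "x i = y i + B * z i" for i by (simp add: y_def z_def)
  have eq: "(\<Sum>i=1..k. y i) - int k * y 0 = B * (int k * z 0 - (\<Sum>i=1..k. z i))"
    using Suc.prems(2) unfolding x sum.distrib sum_distrib_left[symmetric]
    by (simp only: algebra_simps)
  then have "B dvd (\<Sum>i=1..k. y i) - int k * y 0" by simp
  then have sy: "(\<Sum>i=1..k. y i) = int k * y 0"
    using assms(1-3) yz(1) by (intro average_digits[of k y d B]) (assumption | linarith)+
  then have sz: "(\<Sum>i=1..k. z i) = int k * z 0" using eq assms(2,3) by simp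
  have IH1: "int k * digit_sq B n (z 0) \<le> (\<Sum>i=1..k. digit_sq B n (z i))"
    and IH2: "(\<Sum>i=1..k. digit_sq B n (z i)) = int k * digit_sq B n (z 0) \<Longrightarrow> \<forall>i\<le>k. z i = z 0"
    using Suc.IH[OF yz(2) sz] by blast+
  have dq: "digit_sq B (Suc n) (x i) = (y i)\<^sup>2 + digit_sq B n (z i)" for i
    by (simp add: y_def z_def)
  have dev: "(\<Sum>i=1..k. (y i)\<^sup>2) = int k * (y 0)\<^sup>2 + (\<Sum>i=1..k. (y i - y 0)\<^sup>2)"
    by (rule sum_squares_deviation[OF sy])
  have nn: "0 \<le> (\<Sum>i=1..k. (y i - y 0)\<^sup>2)" by (intro sum_nonneg) auto
  show ?case
  proof (intro conjI impI)
    show "int k * digit_sq B (Suc n) (x 0) \<le> (\<Sum>i=1..k. digit_sq B (Suc n) (x i))"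
      unfolding dq sum.distrib dev using IH1 nn by (simp add: algebra_simps)
  next
    assume "(\<Sum>i=1..k. digit_sq B (Suc n) (x i)) = int k * digit_sq B (Suc n) (x 0)"
    then have "(\<Sum>i=1..k. (y i - y 0)\<^sup>2) + (\<Sum>i=1..k. digit_sq B n (z i)) = int k * digit_sq B n (z 0)"
      unfolding dq sum.distrib dev by (simp add: algebra_simps)
    then have "(\<Sum>i=1..k. (y i - y 0)\<^sup>2) = 0"
      and "(\<Sum>i=1..k. digit_sq B n (z i)) = int k * digit_sq B n (z 0)"
      using IH1 nn by auto
    then have yy: "\<forall>i\<in>{1..k}. (y i - y 0)\<^sup>2 = 0" and zz: "\<forall>i\<le>k. z i = z 0"
      by (simp add: sum_nonneg_eq_0_iff, intro IH2)
    have "y i = y 0" if "i \<le> k" for i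
      using bspec[OF yy, of i] that by (cases "i = 0") auto
    then show "\<forall>i\<le>k. x i = x 0" using zz x by metis
  qed
qed simp

lemma digit_sq_bounds:
  assumes "0 < d" "d \<le> B" "x \<in> expansions B {0..<d} n"
  shows "digit_sq B n x \<in> {0..int n * d\<^sup>2}"
  using assms(3)
proof (induction n arbitrary: x)
  case (Suc n)
  have sub: "{0..<d} \<subseteq> {0..<B}" using assms(2) by auto
  have 1: "x mod B \<in> {0..<d}" "x div B \<in> expansions B {0..<d} n"
    using Suc.prems unfolding expansions_Suc_iff[OF sub] by auto
  have "(x mod B)\<^sup>2 \<le> d\<^sup>2" using 1(1) by (intro power_mono) auto
  then show ?case using Suc.IH[OF 1(2)] by (simp add: algebra_simps)
qed simp

text \<open>All \<open>k \<le> t\<close> are covered at once so that a single digit set serves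
  orderings of every length. For \<open>k = 2\<close> the condition excludes nonconstant three-term
  progressions.\<close>

definition average_free :: "nat \<Rightarrow> int set \<Rightarrow> bool" where
  "average_free t Y \<longleftrightarrow> (\<forall>k\<le>t. \<forall>y. (\<forall>i\<le>k. y i \<in> Y) \<and> (\<Sum>i=1..k. y i) = int k * y 0
     \<longrightarrow> (\<forall>i\<le>k. y i = y 0))"

text \<open>Serves twice: to pick a populous sphere, and to pick a frequent difference of two
  sets.\<close>

lemma pigeonhole_level_set:
  assumes "finite A" "finite V" "f ` A \<subseteq> V" "V \<noteq> {}"
  shows "\<exists>v\<in>V. card A \<le> card V * card {a \<in> A. f a = v}"
proof (rule ccontr)
  assume "\<not> ?thesis"
  then have lt: "\<And>v. v \<in> V \<Longrightarrow> card V * card {a \<in> A. f a = v} < card A" by force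
  have "card V * card A = card V * (\<Sum>v\<in>V. card {a \<in> A. f a = v})"
    using sum.group[OF assms(1-3), of "\<lambda>_. 1::nat"] by simp
  also have "\<dots> < card V * card A"
    unfolding sum_distrib_left
    using sum_strict_mono[OF assms(2,4), of "\<lambda>v. card V * card {a \<in> A. f a = v}" "\<lambda>_. card A"] lt by simp
  finally show False by simp
qed

text \<open>The density is measured against \<open>C * P\<close> because the moduli later used as
  bases are known only to be at most \<open>C * P\<close>. A fixed dimension \<open>n\<close>
  suffices for a loss of \<open>\<eta>\<close> in the exponent.\<close>

lemma behrend:
  fixes t C :: nat and \<eta> :: real
  assumes t: "t \<ge> 1" and C: "C \<ge> 1" and \<eta>: "0 < \<eta>"
  shows "\<exists>(P::nat) Y. P \<ge> 1 \<and> Y \<subseteq> {0..<int P} \<and> average_free t Y \<and>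
           real (card Y) \<ge> (real C * real P) powr (1 - \<eta>)"
proof -
  obtain n :: nat where n: "3 / \<eta> \<le> real n" using real_arch_simple by blast
  then have n3: "3 \<le> real n * \<eta>" using \<eta> by (simp add: field_simps)
  \<comment> \<open>The base is \<open>t * d\<close>. This \<open>d\<close> makes \<open>d ^ n / ((n + 1) * d\<^sup>2) = C * (t * d) ^ n / d ^ 3\<close>,
    and \<open>d ^ 3 \<le> P powr \<eta>\<close> by the choice of \<open>n\<close>.\<close>
  define d where "d = (n + 1) * C * t ^ n"
  have d1: "d \<ge> 1" using t C by (simp add: d_def)
  define B where "B = int (t * d)"
  define P where "P = (t * d) ^ n"
  have dB: "0 < int d" "int d \<le> B" using d1 t by (auto simp: B_def)
  have P1: "P \<ge> 1" using t d1 by (simp add: P_def)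
  define E where "E = expansions B {0..<int d} n"
  have sub: "{0..<int d} \<subseteq> {0..<B}" using dB by auto
  have E: "E \<subseteq> {0..<int P}" using expansions_bound[OF sub, of n] by (simp add: E_def P_def B_def)
  have cE: "card E = d ^ n" unfolding E_def card_expansions[OF sub] by simp
  \<comment> \<open>\<open>E\<close> consists of all vectors of \<open>n\<close> digits below
    \<open>d\<close>; some sphere contains at least the average share of it.\<close>
  have "\<exists>v\<in>{0..int n * (int d)\<^sup>2}. card E \<le> card {0..int n * (int d)\<^sup>2} * card {a \<in> E. digit_sq B n a = v}"
    using digit_sq_bounds[OF dB, of _ n] finite_subset[OF E]
    by (intro pigeonhole_level_set) (auto simp: E_def)
  then obtain v where v: "card E \<le> card {0..int n * (int d)\<^sup>2} * card {a \<in> E. digit_sq B n a = v}" by blast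
  define Y where "Y = {a \<in> E. digit_sq B n a = v}"
  have "average_free t Y"
    unfolding average_free_def
  proof (intro allI impI, elim conjE)
    fix k y i assume k: "k \<le> t" and y: "\<forall>i\<le>k. y i \<in> Y" and s: "(\<Sum>i=1..k. y i) = int k * y 0" and i: "i \<le> k"
    have "(\<Sum>i=1..k. digit_sq B n (y i)) = (\<Sum>i=1..k. v)"
      using y by (intro sum.cong) (auto simp: Y_def)
    also have "\<dots> = int k * digit_sq B n (y 0)" using y by (auto simp: Y_def)
    finally have eq: "(\<Sum>i=1..k. digit_sq B n (y i)) = int k * digit_sq B n (y 0)" .
    have "int k * int d \<le> B" using k by (simp add: B_def mult_right_mono)
    moreover have "\<And>j. j \<le> k \<Longrightarrow> y j \<in> expansions B {0..<int d} n"
      using y unfolding Y_def E_def by blast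
    ultimately show "y i = y 0"
      using digit_sq_convex[OF _ dB _ s] eq i by blast
  qed
  moreover have "real (card Y) \<ge> (real C * real P) powr (1 - \<eta>)"
  proof -
    have "card {0..int n * (int d)\<^sup>2} = n * d\<^sup>2 + 1"
      by (simp add: nat_add_distrib nat_mult_distrib nat_power_eq)
    also have "\<dots> \<le> (n + 1) * d\<^sup>2" using d1 by simp
    finally have "d ^ n \<le> (n + 1) * d\<^sup>2 * card Y"
      using v unfolding cE Y_def[symmetric] by (meson le_trans mult_le_mono1)
    then have "d ^ n * d \<le> (n + 1) * d\<^sup>2 * card Y * d" by simp
    moreover have "d ^ n * d = (n + 1) * (C * (t ^ n * d ^ n))"
      by (subst (2) d_def) (simp only: ac_simps)
    moreover have "(n + 1) * d\<^sup>2 * card Y * d = (n + 1) * (card Y * d ^ 3)"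
      by (simp only: power2_eq_square power3_eq_cube ac_simps)
    ultimately have "(n + 1) * (C * (t ^ n * d ^ n)) \<le> (n + 1) * (card Y * d ^ 3)" by simp
    then have "C * (t ^ n * d ^ n) \<le> card Y * d ^ 3" unfolding mult_le_cancel1 by simp
    then have "C * P \<le> card Y * d ^ 3" by (simp add: P_def power_mult_distrib)
    then have 1: "real C * real P \<le> real (card Y) * real d ^ 3"
      by (metis of_nat_le_iff of_nat_mult of_nat_power)
    have CP: "real d ^ n \<le> real C * real P"
    proof -
      have "1 * d ^ n \<le> (C * t ^ n) * d ^ n" using C t by (intro mult_right_mono) auto
      then have "d ^ n \<le> C * P" by (simp add: P_def power_mult_distrib mult.assoc)
      then show ?thesis by (metis of_nat_le_iff of_nat_mult of_nat_power)
    qed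
    have "real d ^ 3 = real d powr 3" using d1 by (simp add: powr_numeral)
    also have "\<dots> \<le> real d powr (real n * \<eta>)" using d1 n3 by (intro powr_mono) auto
    also have "\<dots> = (real d ^ n) powr \<eta>" using d1 by (simp add: powr_powr[symmetric] powr_realpow)
    also have "\<dots> \<le> (real C * real P) powr \<eta>" using CP \<eta> by (intro powr_mono2) auto
    finally have 2: "real d ^ 3 \<le> (real C * real P) powr \<eta>" .
    have pos: "real C * real P > 0" using C P1 by simp
    have "real C * real P \<le> real (card Y) * (real C * real P) powr \<eta>"
      using 1 2 by (meson mult_left_mono of_nat_0_le_iff order_trans)
    then have "real C * real P / (real C * real P) powr \<eta> \<le> real (card Y)"
      using pos by (simp add: divide_le_eq)
    then show ?thesis using pos by (simp add: powr_diff)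
  qed
  moreover have "Y \<subseteq> {0..<int P}" using E by (auto simp: Y_def)
  ultimately show ?thesis using P1 by blast
qed

section \<open>Equations with coefficients congruent to 1\<close>

text \<open>Modulo \<open>p\<close> every coefficient is 1, so the lowest digits satisfy the plain
  averaging congruence and, lacking carries, the equation; hence they agree. Then they drop out, and
  the higher digits satisfy the same equation with the same coefficients.\<close>

lemma expansions_weighted_average:
  fixes a x :: "nat \<Rightarrow> int"
  assumes Y: "Y \<subseteq> {0..<d}" "average_free t Y" and p: "int t * d \<le> p" "d \<le> p" "0 < p"
    and K: "K \<le> t" and a: "\<And>i. i \<in> {1..K} \<Longrightarrow> p dvd a i - 1"
    and x: "\<And>i. i \<le> K \<Longrightarrow> x i \<in> expansions p Y m"
    and eq: "(\<Sum>i=1..K. a i * (x i - x 0)) = 0" and i: "i \<le> K"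
  shows "x i = x 0"
  using x eq i
proof (induction m arbitrary: x i)
  case (Suc m)
  define y z where "y = (\<lambda>i. x i mod p)" and "z = (\<lambda>i. x i div p)"
  have sub: "Y \<subseteq> {0..<p}" using Y(1) p(2) by auto
  have y: "y j \<in> Y" and z: "z j \<in> expansions p Y m" if "j \<le> K" for j
    using Suc.prems(1)[OF that] unfolding expansions_Suc_iff[OF sub] y_def z_def by auto
  have x: "x j = y j + p * z j" for j by (simp add: y_def z_def)
  have split: "(\<Sum>j=1..K. a j * (y j - y 0)) + p * (\<Sum>j=1..K. a j * (z j - z 0)) = 0"
    unfolding Suc.prems(2)[symmetric] sum_distrib_left sum.distrib[symmetric] x
    by (intro sum.cong) (simp_all add: algebra_simps)
  then have "(\<Sum>j=1..K. a j * (y j - y 0)) = p * (- (\<Sum>j=1..K. a j * (z j - z 0)))"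
    by simp
  then have 1: "p dvd (\<Sum>j=1..K. a j * (y j - y 0))" by (rule dvdI)
  \<comment> \<open>Replacing each \<open>a j\<close> by 1 changes the sum by a multiple of
    \<open>p\<close>.\<close>
  have 2: "p dvd (\<Sum>j=1..K. (a j - 1) * (y j - y 0))"
    using a by (intro dvd_sum dvd_mult2) auto
  have "(\<Sum>j=1..K. a j * (y j - y 0)) - (\<Sum>j=1..K. (a j - 1) * (y j - y 0)) = (\<Sum>j=1..K. y j) - int K * y 0"
    unfolding sum_subtractf[symmetric] by (simp add: algebra_simps sum.distrib sum_subtractf)
  then have 3: "p dvd (\<Sum>j=1..K. y j) - int K * y 0" using dvd_diff[OF 1 2] by simp
  have yd: "y j \<in> {0..<d}" if "j \<le> K" for j using y[OF that] Y(1) by blast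
  have "int K * d \<le> p"
  proof (cases "0 \<le> d")
    case True
    then have "int K * d \<le> int t * d" using K by (intro mult_right_mono) auto
    then show ?thesis using p by linarith
  next
    case False
    then have "int K * d \<le> 0" by (simp add: mult_nonneg_nonpos)
    then show ?thesis using p by linarith
  qed
  then have "(\<Sum>j=1..K. y j) = int K * y 0"
    using yd p(3) 3 by (intro average_digits[of K y d p])
  then have yy: "y j = y 0" if "j \<le> K" for j
    using Y(2) K y that unfolding average_free_def by blast
  \<comment> \<open>Equal digits cancel exactly, not only modulo \<open>p\<close>, so what is left
    of \<open>split\<close> can be divided by \<open>p\<close>.\<close>
  have "(\<Sum>j=1..K. a j * (y j - y 0)) = 0"
  proof (intro sum.neutral ballI)
    fix j assume "j \<in> {1..K}"
    then have "y j = y 0" by (intro yy) simp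
    then show "a j * (y j - y 0) = 0" by simp
  qed
  then have "(\<Sum>j=1..K. a j * (z j - z 0)) = 0" using split p by simp
  then have "z i = z 0" using Suc.IH[of z i] z Suc.prems(3) by blast
  then show ?case using yy[OF Suc.prems(3)] unfolding x by simp
qed simp

text \<open>The coefficients telescope to total 0, so the first is minus the sum of the others. In
  terms of differences from the first unknown, the invariance under translation is visible.\<close>

lemma sum_cyclic_equation:
  assumes "length U = Suc K"
  shows "(\<Sum>i<Suc K. cyclic_equation U ! i * (f i :: int)) =
    (\<Sum>i=1..K. (U ! i - U ! (i - 1)) * (f i - f 0))"
proof -
  have dist: "(\<Sum>i=1..K. g i * (f i - f 0)) = (\<Sum>i=1..K. g i * f i) - (\<Sum>i=1..K. g i) * f 0" for g
    by (simp add: right_diff_distrib sum_subtractf sum_distrib_right)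
  have tele: "(\<Sum>i=1..L. U ! i - U ! (i - 1)) = U ! L - U ! 0" for L
    by (induction L) auto
  have "(\<Sum>i<Suc K. cyclic_equation U ! i * f i) =
      cyclic_equation U ! 0 * f 0 + (\<Sum>i=1..K. cyclic_equation U ! i * f i)"
    unfolding sum.lessThan_Suc_shift
    by (simp add: sum.atLeast1_atMost_eq)
  also have "(\<Sum>i=1..K. cyclic_equation U ! i * f i) = (\<Sum>i=1..K. (U ! i - U ! (i - 1)) * f i)"
    using assms by (intro sum.cong) (auto simp: cyclic_equation_def simp del: upt_Suc)
  also have "cyclic_equation U ! 0 = - (\<Sum>i=1..K. U ! i - U ! (i - 1))"
    unfolding tele using assms by (simp add: cyclic_equation_def del: upt_Suc)
  finally show ?thesis unfolding dist by simp
qed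

lemma length_cyclic_equation [simp]: "length (cyclic_equation U) = length U"
  by (simp add: cyclic_equation_def)

text \<open>Successive entries of \<open>U\<close> differ by 1 modulo \<open>p\<close>, so all
  coefficients but the first are 1 there. The bound is \<open>Suc t\<close> because the first
  unknown is not counted among the averaged ones.\<close>

lemma expansions_solution_free:
  assumes "Y \<subseteq> {0..<d}" "average_free t Y" "int t * d \<le> p" "d \<le> p" "0 < p"
    and U: "U \<noteq> []" "length U \<le> Suc t" "\<And>j. j < length U \<Longrightarrow> p dvd U ! j - int j"
  shows "solution_free (cyclic_equation U) (expansions p Y m)"
  unfolding solution_free_def
proof (intro allI impI, elim conjE)
  fix xs assume xs: "set xs \<subseteq> expansions p Y m" and sol: "is_solution (cyclic_equation U) xs"
  obtain K where K: "length U = Suc K" using U(1) by (cases U) auto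
  have len: "length xs = Suc K" using sol K by (simp add: is_solution_def)
  have "(\<Sum>i=1..K. (U ! i - U ! (i - 1)) * (xs ! i - xs ! 0)) = 0"
    using sol sum_cyclic_equation[OF K, of "nth xs"] K unfolding is_solution_def by simp
  moreover have "p dvd (U ! i - U ! (i - 1)) - 1" if "i \<in> {1..K}" for i
  proof -
    have "p dvd (U ! i - int i) - (U ! (i - 1) - int (i - 1))"
      using that K by (intro dvd_diff U(3)) auto
    then show ?thesis using that by (simp add: of_nat_diff algebra_simps)
  qed
  moreover have "xs ! i \<in> expansions p Y m" if "i \<le> K" for i
    using xs len that by (simp add: subset_iff)
  ultimately have "xs ! i = xs ! 0" if "i \<le> K" for i
    using expansions_weighted_average[OF assms(1-5), of K "\<lambda>i. U ! i - U ! (i - 1)" "nth xs" m i]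
      U(2) K that by simp
  then show "trivial_assignment xs" unfolding trivial_assignment_def len by (metis less_Suc_eq_le)
qed

section \<open>Intersecting translates\<close>

lemma solution_free_translate:
  assumes "solution_free (cyclic_equation U) M" "M' \<subseteq> (\<lambda>x. s + x) ` M"
  shows "solution_free (cyclic_equation U) M'"
\<comment> \<open>The rewriting of the equation presupposes a first entry; for the empty list only
  the empty assignment qualifies.\<close>
proof (cases "U = []")
  case True
  then show ?thesis by (auto simp: solution_free_def is_solution_def trivial_assignment_def)
next
  case False
  show ?thesis
    unfolding solution_free_def
  proof (intro allI impI, elim conjE)
    fix xs assume xs: "set xs \<subseteq> M'" and sol: "is_solution (cyclic_equation U) xs"
    obtain K where K: "length U = Suc K" using False by (cases U) auto
    define ys where "ys = map (\<lambda>x. x - s) xs"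
    have len: "length xs = Suc K" using sol K by (simp add: is_solution_def)
    have ys: "ys ! i = xs ! i - s" if "i < Suc K" for i using that len by (simp add: ys_def)
    have "(\<Sum>i<Suc K. cyclic_equation U ! i * ys ! i) = (\<Sum>i<Suc K. cyclic_equation U ! i * xs ! i)"
      unfolding sum_cyclic_equation[OF K] by (intro sum.cong) (auto simp: ys)
    then have "is_solution (cyclic_equation U) ys"
      using sol K len by (simp add: is_solution_def ys_def)
    moreover have "set ys \<subseteq> M" using xs assms(2) by (auto simp: ys_def)
    ultimately have "trivial_assignment ys" using assms(1) by (simp add: solution_free_def)
    then have "xs ! i - s = xs ! j - s" if "i < Suc K" "j < Suc K" for i j
      using that ys len by (metis length_map trivial_assignment_def ys_def)
    then show "trivial_assignment xs" unfolding trivial_assignment_def len by (metis diff_add_cancel)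
  qed
qed

text \<open>The pairs in \<open>A \<times> B\<close> have at most \<open>2 * N + 1\<close>
  differences. For one that occurs at least average often, each pair is determined by its first
  component, which lies in \<open>A\<close> and in the translate of \<open>B\<close>.\<close>

lemma large_translate_intersection:
  fixes A B :: "int set"
  assumes "A \<subseteq> {0..int N}" "B \<subseteq> {0..int N}"
  shows "\<exists>s. card A * card B \<le> (2 * N + 1) * card (A \<inter> (\<lambda>x. s + x) ` B)"
proof -
  have fin: "finite A" "finite B" using assms finite_subset by blast+
  have "\<exists>s\<in>{- int N..int N}. card (A \<times> B) \<le> card {- int N..int N} * card {ab \<in> A \<times> B. fst ab - snd ab = s}"
    using assms fin by (intro pigeonhole_level_set) force+
  then obtain s where s: "card A * card B \<le> (2 * N + 1) * card {ab \<in> A \<times> B. fst ab - snd ab = s}"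
    by (auto simp: card_cartesian_product nat_add_distrib nat_mult_distrib)
  have "card {ab \<in> A \<times> B. fst ab - snd ab = s} \<le> card (A \<inter> (\<lambda>x. s + x) ` B)"
    using fin by (intro card_inj_on_le[of fst]) (auto simp: inj_on_def image_iff)
  then show ?thesis using s by (meson le_trans mult_le_mono2)
qed

text \<open>Each further set costs at most its density factor. The induction starts from the full
  interval, so every set of the family is translated and the result stays inside
  \<open>{0..int N}\<close>.\<close>

lemma common_translates:
  fixes M :: "'a \<Rightarrow> int set"
  assumes "finite J" "\<forall>j\<in>J. M j \<subseteq> {0..int N}"
  shows "\<exists>D \<subseteq> {0..int N}. (\<forall>j\<in>J. \<exists>s. D \<subseteq> (\<lambda>x. s + x) ` M j) \<and>
    real (N + 1) * (\<Prod>j\<in>J. real (card (M j)) / real (2 * N + 1)) \<le> real (card D)"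
  using assms
proof (induction J rule: finite_induct)
  case empty
  show ?case by (intro exI[of _ "{0..int N}"]) auto
next
  case (insert j J)
  have "\<forall>i\<in>J. M i \<subseteq> {0..int N}" using insert.prems by blast
  from insert.IH[OF this] obtain D where D: "D \<subseteq> {0..int N}"
    "\<forall>i\<in>J. \<exists>s. D \<subseteq> (\<lambda>x. s + x) ` M i"
    "real (N + 1) * (\<Prod>j\<in>J. real (card (M j)) / real (2 * N + 1)) \<le> real (card D)"
    by blast
  obtain s where s: "card D * card (M j) \<le> (2 * N + 1) * card (D \<inter> (\<lambda>x. s + x) ` M j)"
    using large_translate_intersection[OF D(1)] insert.prems by blast
  define D' where "D' = D \<inter> (\<lambda>x. s + x) ` M j"
  have "real (card D) * real (card (M j)) \<le> real (2 * N + 1) * real (card D')"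
    using s unfolding D'_def by (metis of_nat_le_iff of_nat_mult)
  then have "real (card D) * (real (card (M j)) / real (2 * N + 1)) \<le> real (card D')"
    by (simp add: field_simps)
  moreover have "real (N + 1) * (\<Prod>j\<in>J. real (card (M j)) / real (2 * N + 1)) * (real (card (M j)) / real (2 * N + 1))
     \<le> real (card D) * (real (card (M j)) / real (2 * N + 1))"
    using D(3) by (intro mult_right_mono) auto
  ultimately have "real (N + 1) * (\<Prod>j\<in>insert j J. real (card (M j)) / real (2 * N + 1)) \<le> real (card D')"
    using insert.hyps by (simp add: mult_ac)
  moreover have "\<exists>s. D' \<subseteq> (\<lambda>x. s + x) ` M i" if "i \<in> insert j J" for i
    using that D(2) unfolding D'_def by blast
  moreover have "D' \<subseteq> {0..int N}" using D(1) by (auto simp: D'_def)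
  ultimately show ?case by blast
qed

section \<open>Coprime moduli, densities of digit sets and simultaneous orderings\<close>

text \<open>The idea behind Goedel's beta function: a common divisor divides
  \<open>A * (j - i)\<close>, whereas \<open>Suc (A * i)\<close> is coprime to \<open>A\<close> and
  hence to its divisor \<open>j - i\<close>.\<close>

lemma coprime_Suc_mult:
  fixes A i j :: nat
  assumes "i < j" "j - i dvd A"
  shows "coprime (Suc (A * i)) (Suc (A * j))"
proof -
  have "coprime (Suc (A * i)) A"
    using coprime_Suc_left_nat[of "A * i"] by (cases "i = 0") auto
  moreover from this have "coprime (Suc (A * i)) (j - i)"
    using assms(2) coprime_divisors dvd_refl by blast
  ultimately have "coprime (Suc (A * i)) (A * (j - i))" by simp
  moreover have "Suc (A * j) = Suc (A * i) + A * (j - i)"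
    using assms(1) by (simp add: diff_mult_distrib2)
  ultimately show ?thesis by (metis coprime_iff_gcd_eq_1 gcd_add2)
qed

text \<open>Rounding \<open>N + 1\<close> down to a power of \<open>p\<close> loses a factor below
  \<open>p\<close>, and comparing with \<open>2 * N + 1\<close> loses another factor 2. Only the
  power \<open>- e\<close> makes the loss grow with \<open>N\<close>.\<close>

lemma card_expansions_ge:
  fixes p N :: nat and e :: real
  assumes Y: "Y \<subseteq> {0..<int p}" and p: "p \<ge> 2" and e: "0 \<le> e" "e \<le> 1"
    and cY: "real p powr (1 - e) \<le> real (card Y)"
  shows "\<exists>m. expansions (int p) Y m \<subseteq> {0..int N} \<and>
    real (N + 1) powr (- e) / (2 * real p) \<le> real (card (expansions (int p) Y m)) / real (2 * N + 1)"
proof -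
  obtain m where m: "p ^ m \<le> N + 1" "N + 1 < p ^ (m + 1)"
    using ex_power_ivl1[OF p, of "N + 1"] by auto
  have "{0..<int p ^ m} \<subseteq> {0..int N}"
  proof -
    have "int p ^ m \<le> int N + 1" using m(1) by (metis of_nat_1 of_nat_add of_nat_le_iff of_nat_power)
    then show ?thesis by auto
  qed
  then have sub: "expansions (int p) Y m \<subseteq> {0..int N}" using expansions_bound[OF Y] by blast
  have "real (N + 1) \<le> real p * real p ^ m"
    using m(2) by (metis Suc_eq_plus1 less_imp_le of_nat_le_iff of_nat_mult of_nat_power power_Suc)
  then have "real (N + 1) / real p \<le> real p ^ m" using p by (simp add: divide_le_eq mult.commute)
  then have "(real (N + 1) / real p) powr (1 - e) \<le> (real p ^ m) powr (1 - e)"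
    using e by (intro powr_mono2) auto
  also have "\<dots> = (real p powr (1 - e)) ^ m"
    using p by (simp add: powr_realpow[symmetric] powr_powr mult.commute)
  also have "\<dots> \<le> real (card Y) ^ m" using cY by (intro power_mono) auto
  also have "\<dots> = real (card (expansions (int p) Y m))" by (simp add: card_expansions[OF Y])
  finally have 1: "(real (N + 1) / real p) powr (1 - e) \<le> real (card (expansions (int p) Y m))" .
  have "real p powr (1 - e) \<le> real p powr 1" using p e by (intro powr_mono) auto
  then have 2: "real p powr (1 - e) \<le> real p" using p by simp
  have "real (N + 1) powr (1 - e) / real p \<le> real (N + 1) powr (1 - e) / real p powr (1 - e)"
    using 2 p by (intro divide_left_mono) auto
  also have "\<dots> = (real (N + 1) / real p) powr (1 - e)" by (simp add: powr_divide)
  finally have 3: "real (N + 1) powr (1 - e) / real p \<le> real (card (expansions (int p) Y m))"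
    using 1 by linarith
  have "X powr (- e) / (2 * real p) = X powr (1 - e) / real p / (2 * X)" if "0 < X" for X
    using that powr_add[of X 1 "- e"] by simp
  then have "real (N + 1) powr (- e) / (2 * real p) = real (N + 1) powr (1 - e) / real p / (2 * real (N + 1))"
    by simp
  also have "\<dots> \<le> real (N + 1) powr (1 - e) / real p / real (2 * N + 1)"
    by (intro divide_left_mono) auto
  also have "\<dots> \<le> real (card (expansions (int p) Y m)) / real (2 * N + 1)"
    using 3 by (rule divide_right_mono) simp
  finally show ?thesis using sub by blast
qed

text \<open>All moduli exceed \<open>a\<close> but only by a factor depending on
  \<open>card W\<close>; this factor is what \<open>C\<close> in \<open>behrend\<close>
  accommodates.\<close>

lemma ex_coprime_moduli:
  fixes W :: "'a set" and a :: nat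
  assumes "finite W" "a \<ge> 1"
  shows "\<exists>p. (\<forall>w\<in>W. a < p w \<and> p w \<le> Suc (fact (card W) * a * card W)) \<and>
    (\<forall>v\<in>W. \<forall>w\<in>W. v \<noteq> w \<longrightarrow> coprime (p v) (p w :: nat))"
proof -
  define T where "T = card W"
  define A where "A = fact T * a"
  obtain h where h: "bij_betw h W {0..<T}" using ex_bij_betw_finite_nat[OF assms(1)] T_def by blast
  \<comment> \<open>Since \<open>h\<close> may take the value 0, \<open>Suc\<close> keeps every
    modulus above \<open>a\<close>. Differences of values of \<open>h\<close> are below
    \<open>T\<close>, so they divide \<open>fact T\<close>.\<close>
  define p where "p w = Suc (A * Suc (h w))" for w
  have hT: "h w < T" if "w \<in> W" for w using bij_betwE[OF h] that by auto
  have cop: "coprime (p v) (p w)" if "v \<in> W" "w \<in> W" "h v < h w" for v w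
  proof -
    have "Suc (h w) - Suc (h v) dvd fact T"
      using that hT[of w] by (intro dvd_fact) auto
    then show ?thesis unfolding p_def A_def using that by (intro coprime_Suc_mult dvd_mult2) auto
  qed
  have "a < p w \<and> p w \<le> Suc (fact T * a * T)" if "w \<in> W" for w
  proof
    have "1 * a \<le> fact T * a" by (intro mult_right_mono) (auto simp: Suc_le_eq)
    moreover have "A * 1 \<le> A * Suc (h w)" by (intro mult_left_mono) auto
    ultimately show "a < p w" unfolding p_def A_def by linarith
    show "p w \<le> Suc (fact T * a * T)"
      using hT[OF that] unfolding p_def A_def by (simp only: Suc_le_mono) (intro mult_left_mono; simp)
  qed
  moreover have "coprime (p v) (p w)" if "v \<in> W" "w \<in> W" "v \<noteq> w" for v w
  proof -
    have "h v \<noteq> h w" using h that by (metis bij_betw_def inj_on_def)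
    then show ?thesis using cop that by (metis coprime_commute linorder_neqE_nat)
  qed
  ultimately show ?thesis unfolding T_def by blast
qed

text \<open>Each index is treated separately: the Chinese remainder theorem prescribes its position
  in \<open>w\<close> as residue modulo \<open>p w\<close>, for all \<open>w\<close>
  simultaneously.\<close>

lemma ex_simultaneous_orderings:
  fixes p :: "nat list \<Rightarrow> nat"
  assumes fin: "finite W" and dist: "\<And>w. w \<in> W \<Longrightarrow> distinct w"
    and cop: "\<forall>v\<in>W. \<forall>w\<in>W. v \<noteq> w \<longrightarrow> coprime (p v) (p w)"
  shows "\<exists>r :: nat \<Rightarrow> nat. \<forall>w\<in>W. \<forall>j<length w. [r (w ! j) = j] (mod p w)"
proof -
  \<comment> \<open>For an index that does not occur in \<open>w\<close> this is an unspecified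
    number, so that a residue is prescribed in every case.\<close>
  define pos where "pos w i = the (map_of (zip w [0..<length w]) i)" for w and i :: nat
  have pos: "pos w (w ! j) = j" if "w \<in> W" "j < length w" for w j
    using map_of_zip_nth[of w "[0..<length w]" j] dist that by (simp add: pos_def)
  have "\<exists>x. \<forall>w\<in>W. [x = pos w i] (mod p w)" for i
    by (rule chinese_remainder_nat[OF fin cop])
  then obtain r where r: "\<And>i w. w \<in> W \<Longrightarrow> [r i = pos w i] (mod p w)" by metis
  have "[r (w ! j) = j] (mod p w)" if "w \<in> W" "j < length w" for w j
    using r[OF that(1), of "w ! j"] pos[OF that] by simp
  then show ?thesis by blast
qed

section \<open>A fixed set of integers for each exponent loss\<close>

text \<open>\<open>R\<close> and \<open>c\<close> are fixed before \<open>N\<close>, so the rank of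
  \<open>R\<close> stays constant while \<open>N\<close> grows; this later bounds it by arbitrarily
  small powers of \<open>q\<close>.\<close>

lemma ex_fixed_set_dense_solution_free:
  fixes t :: nat and \<eta> :: real
  assumes t: "t \<ge> 1" and \<eta>: "0 < \<eta>" "\<eta> \<le> 1"
  shows "\<exists>(R :: int set) c. 0 < c \<and> finite R \<and> R \<subseteq> {0..} \<and> card R = t \<and>
    (\<forall>N::nat. \<exists>M \<subseteq> {0..int N}. set_solution_free R M \<and> c * real (N + 1) powr (1 - \<eta>) \<le> real (card M))"
proof -
  define W where "W = {w. set w \<subseteq> {..<t} \<and> distinct w}"
  define T where "T = card W"
  have finW: "finite W" unfolding W_def by (rule finite_subset_distinct) simp
  \<comment> \<open>The full ordering shows that \<open>W\<close> is nonempty and, further below,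
    that \<open>r\<close> is injective.\<close>
  have upt: "[0..<t] \<in> W" by (auto simp: W_def)
  then have T: "T \<ge> 1" using finW unfolding T_def by (metis One_nat_def Suc_leI card_gt_0_iff empty_iff)
  \<comment> \<open>Each of the \<open>T\<close> intersected sets may lose this exponent; the losses
    add up to \<open>\<eta>\<close>.\<close>
  define e where "e = \<eta> / real T"
  have e: "0 < e" "e \<le> 1" and eT: "e * real T = \<eta>"
    using \<eta> T by (auto simp: e_def divide_le_eq)
  \<comment> \<open>Makes the bound \<open>Suc (fact T * (t * P) * T)\<close> on the moduli at most
    \<open>C * P\<close>, yet does not involve \<open>P\<close>, which \<open>behrend\<close>
    supplies only afterwards.\<close>
  define C where "C = Suc (fact T * t * T)"
  obtain P :: nat and Y where P: "P \<ge> 1" and Y: "Y \<subseteq> {0..<int P}" "average_free t Y"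
    and cY: "(real C * real P) powr (1 - e) \<le> real (card Y)"
    using behrend[of t C e] t e by (auto simp: C_def)
  obtain p where p: "\<And>w. w \<in> W \<Longrightarrow> t * P < p w" "\<And>w. w \<in> W \<Longrightarrow> p w \<le> Suc (fact T * (t * P) * T)"
    and cop: "\<forall>v\<in>W. \<forall>w\<in>W. v \<noteq> w \<longrightarrow> coprime (p v) (p w)"
    using ex_coprime_moduli[OF finW, of "t * P"] t P unfolding T_def by auto
  have tP: "t \<le> t * P" "P \<le> t * P" using t P by auto
  have distW: "distinct w" if "w \<in> W" for w using that by (simp add: W_def)
  obtain r :: "nat \<Rightarrow> nat" where r: "\<And>w j. w \<in> W \<Longrightarrow> j < length w \<Longrightarrow> [r (w ! j) = j] (mod p w)"
    using ex_simultaneous_orderings[OF finW distW cop] by blast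
  define R where "R = (\<lambda>i. int (r i)) ` {..<t}"
  \<comment> \<open>Modulo the modulus of the full ordering, \<open>r i\<close> is congruent to
    \<open>i\<close>, and that modulus exceeds \<open>t\<close>.\<close>
  have "inj_on r {..<t}"
  proof (rule inj_onI)
    fix i j assume ij: "i \<in> {..<t}" "j \<in> {..<t}" "r i = r j"
    have "[i = j] (mod p [0..<t])"
      using r[OF upt, of i] r[OF upt, of j] ij by (auto intro: cong_trans cong_sym)
    moreover have "t < p [0..<t]" using p(1)[OF upt] tP by linarith
    ultimately show "i = j" using ij
      by (intro cong_less_modulus_unique_nat[of i j "p [0..<t]"]) auto
  qed
  then have "inj_on (\<lambda>i. int (r i)) {..<t}" by (auto simp: inj_on_def)
  then have cardR: "card R = t" unfolding R_def by (simp add: card_image)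
  \<comment> \<open>Collects the density factors that do not depend on \<open>N\<close>.\<close>
  define c where "c = (\<Prod>w\<in>W. 1 / (2 * real (p w)))"
  have ppos: "0 < p w" if "w \<in> W" for w using p(1)[OF that] by simp
  have "0 < c" unfolding c_def using ppos by (intro prod_pos) auto
  moreover have "\<exists>M \<subseteq> {0..int N}. set_solution_free R M \<and> c * real (N + 1) powr (1 - \<eta>) \<le> real (card M)" for N
  proof -
    have "\<exists>m. expansions (int (p w)) Y m \<subseteq> {0..int N} \<and>
        real (N + 1) powr (- e) / (2 * real (p w)) \<le> real (card (expansions (int (p w)) Y m)) / real (2 * N + 1)"
      if w: "w \<in> W" for w
    proof (rule card_expansions_ge)
      have "P \<le> p w" using p(1)[OF w] tP by linarith
      then show "Y \<subseteq> {0..<int (p w)}" using Y(1) by auto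
      show "2 \<le> p w" using p(1)[OF w] tP t by linarith
      have "Suc (fact T * (t * P) * T) \<le> C * P" using P by (simp add: C_def algebra_simps)
      then have "p w \<le> C * P" using p(2)[OF w] by linarith
      then have "real (p w) \<le> real C * real P" by (metis of_nat_le_iff of_nat_mult)
      then have "real (p w) powr (1 - e) \<le> (real C * real P) powr (1 - e)"
        using e by (intro powr_mono2) auto
      then show "real (p w) powr (1 - e) \<le> real (card Y)" using cY by linarith
    qed (use e in auto)
    then obtain m where m: "\<And>w. w \<in> W \<Longrightarrow> expansions (int (p w)) Y (m w) \<subseteq> {0..int N}"
      "\<And>w. w \<in> W \<Longrightarrow> real (N + 1) powr (- e) / (2 * real (p w))
          \<le> real (card (expansions (int (p w)) Y (m w))) / real (2 * N + 1)"
      by metis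
    have mW: "\<forall>w\<in>W. expansions (int (p w)) Y (m w) \<subseteq> {0..int N}" using m(1) by blast
    obtain D where D: "D \<subseteq> {0..int N}"
      "\<forall>w\<in>W. \<exists>s. D \<subseteq> (\<lambda>x. s + x) ` expansions (int (p w)) Y (m w)"
      "real (N + 1) * (\<Prod>w\<in>W. real (card (expansions (int (p w)) Y (m w))) / real (2 * N + 1)) \<le> real (card D)"
      using common_translates[OF finW mW] by (elim exE conjE)
    have "set_solution_free R D"
      unfolding set_solution_free_def permutation_sequence_def
    proof (intro allI impI, elim conjE)
      fix k U assume k: "3 \<le> k" "k \<le> card R" and U: "length U = k" "distinct U" "set U \<subseteq> R"
      \<comment> \<open>An ordering \<open>w\<close> that produces \<open>U\<close> is recovered;
        along it the entries of \<open>U\<close> are 0, 1, 2, ... modulo \<open>p w\<close>.\<close>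
      have "U \<in> lists R" using U(3) by (simp add: lists_eq_set)
      then obtain w where w: "set w \<subseteq> {..<t}" "U = map (\<lambda>i. int (r i)) w"
        unfolding R_def lists_image by (auto simp: lists_eq_set)
      then have wW: "w \<in> W" using U(2) by (simp add: W_def distinct_map)
      have "solution_free (cyclic_equation U) (expansions (int (p w)) Y (m w))"
      proof (rule expansions_solution_free[OF Y])
        have "t * P \<le> p w" "P \<le> p w" using p(1)[OF wW] tP by linarith+
        then show "int t * int P \<le> int (p w)" "int P \<le> int (p w)"
          by (metis of_nat_le_iff of_nat_mult, simp)
        show "0 < int (p w)" using ppos[OF wW] by simp
        show "U \<noteq> []" "length U \<le> Suc t" using k U(1) cardR by auto
        fix j assume "j < length U"
        then have j: "j < length w" using w(2) by simp
        have "[int (r (w ! j)) = int j] (mod int (p w))" using r[OF wW j] by (simp add: cong_int_iff)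
        then show "int (p w) dvd U ! j - int j" using j w(2) by (simp add: cong_iff_dvd_diff)
      qed
      then show "solution_free (cyclic_equation U) D"
        using D(2) wW solution_free_translate by blast
    qed
    moreover have "c * real (N + 1) powr (1 - \<eta>) \<le> real (card D)"
    proof -
      have "(\<Prod>w\<in>W. real (N + 1) powr (- e) / (2 * real (p w))) = real (N + 1) powr (- \<eta>) * c"
      proof -
        have "(\<Prod>w\<in>W. real (N + 1) powr (- e) / (2 * real (p w)))
            = (\<Prod>w\<in>W. real (N + 1) powr (- e)) * c"
          unfolding c_def prod.distrib[symmetric] by simp
        also have "(\<Prod>w\<in>W. real (N + 1) powr (- e)) = (real (N + 1) powr (- e)) ^ T"
          by (simp add: T_def)
        also have "\<dots> = real (N + 1) powr (- e * real T)"
          by (subst powr_realpow[symmetric]) (simp_all only: powr_powr, simp)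
        finally show ?thesis using eT by simp
      qed
      moreover have "(\<Prod>w\<in>W. real (N + 1) powr (- e) / (2 * real (p w)))
          \<le> (\<Prod>w\<in>W. real (card (expansions (int (p w)) Y (m w))) / real (2 * N + 1))"
        using m(2) by (intro prod_mono) auto
      ultimately have "real (N + 1) * (real (N + 1) powr (- \<eta>) * c) \<le> real (card D)"
        using D(3) by (smt (verit) mult_left_mono of_nat_0_le_iff)
      moreover have "real (N + 1) powr (1 - \<eta>) = real (N + 1) * real (N + 1) powr (- \<eta>)"
        using powr_add[of "real (N + 1)" 1 "- \<eta>"] by simp
      ultimately show ?thesis by (simp only: mult_ac)
    qed
    ultimately show ?thesis using D(1) by blast
  qed
  moreover have "finite R" "R \<subseteq> {0..}" by (auto simp: R_def)
  ultimately show ?thesis using cardR by blast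
qed

section \<open>Letting the loss tend to 0\<close>

text \<open>\<open>\<delta> q\<close> is the infimum of the admissible losses, pushed up slightly
  because it need not be attained; monotonicity makes the larger value admissible. For every
  \<open>a > 0\<close> the loss \<open>a / 2\<close> is eventually admissible, which forces the
  limit 0.\<close>

lemma eventually_diagonal:
  fixes Q :: "real \<Rightarrow> nat \<Rightarrow> bool"
  assumes ev: "\<And>e. 0 < e \<Longrightarrow> eventually (Q e) sequentially"
    and mono: "\<And>e e' q. Q e q \<Longrightarrow> e \<le> e' \<Longrightarrow> q \<ge> 1 \<Longrightarrow> Q e' q"
  shows "\<exists>\<delta>. \<delta> \<longlonglongrightarrow> 0 \<and> eventually (\<lambda>q. Q (\<delta> q) q) sequentially"
proof -
  define S where "S q = {e. 0 < e \<and> Q e q}" for q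
  define \<delta> where "\<delta> q = Inf (S q) + 1 / real (Suc q)" for q
  have bdd: "bdd_below (S q)" for q by (intro bdd_belowI[of _ 0]) (auto simp: S_def)
  have "Q (\<delta> q) q" if "Q 1 q" "q \<ge> 1" for q
  proof -
    have ne: "S q \<noteq> {}" using that by (auto simp: S_def intro: exI[of _ 1])
    have "Inf (S q) < \<delta> q" by (simp add: \<delta>_def)
    then obtain e where "e \<in> S q" "e < \<delta> q" using cInf_lessD[OF ne] by blast
    then show ?thesis using mono[of e q "\<delta> q"] that by (simp add: S_def)
  qed
  moreover have "eventually (\<lambda>q. Q 1 q \<and> q \<ge> 1) sequentially"
    using ev[of 1] eventually_ge_at_top[of 1] by (simp add: eventually_conj_iff)
  ultimately have 1: "eventually (\<lambda>q. Q (\<delta> q) q) sequentially" by (auto elim: eventually_mono)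
  have "(\<lambda>q. Inf (S q)) \<longlonglongrightarrow> 0"
  proof (rule order_tendstoI)
    fix a :: real assume "a < 0"
    have "eventually (\<lambda>q. Q 1 q) sequentially" using ev by simp
    then show "eventually (\<lambda>q. a < Inf (S q)) sequentially"
    proof eventually_elim
      case (elim q)
      then have "S q \<noteq> {}" by (auto simp: S_def intro: exI[of _ 1])
      then have "0 \<le> Inf (S q)" by (intro cInf_greatest) (auto simp: S_def)
      then show ?case using \<open>a < 0\<close> by simp
    qed
  next
    fix a :: real assume a: "0 < a"
    have "eventually (\<lambda>q. Q (a / 2) q) sequentially" using ev a by simp
    then show "eventually (\<lambda>q. Inf (S q) < a) sequentially"
    proof eventually_elim
      case (elim q)
      then have "a / 2 \<in> S q" using a by (simp add: S_def)
      then have "Inf (S q) \<le> a / 2" by (rule cInf_lower[OF _ bdd])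
      then show ?case using a by simp
    qed
  qed
  then have "\<delta> \<longlonglongrightarrow> 0 + 0"
    unfolding \<delta>_def by (intro tendsto_add LIMSEQ_Suc[OF lim_1_over_n])
  then show ?thesis using 1 by auto
qed

theorem theorem4:
  fixes t :: nat
  assumes "t \<ge> 3"
  shows "\<exists>\<epsilon> \<delta> :: nat \<Rightarrow> real. \<epsilon> \<in> o(\<lambda>_. 1) \<and> \<delta> \<in> o(\<lambda>_. 1) \<and>
    (\<exists>q\<^sub>0. \<forall>q\<ge>q\<^sub>0. \<exists>R M :: int set.
       R \<subseteq> {0..int q - 1} \<and> card R = t \<and>
       M \<subseteq> {0..\<lfloor>(real q - 1) / real_of_int (set_rank R)\<rfloor>} \<and>
       set_solution_free R M \<and>
       real_of_int (set_rank R) = real q powr \<epsilon> q \<and>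
       real (card M) \<ge> real q powr (1 - \<delta> q))"
proof -
  \<comment> \<open>The conditions free of exponents. A rank of at least 1 makes its logarithm
    nonnegative.\<close>
  define G where "G q R M \<longleftrightarrow> R \<subseteq> {0..int q - 1} \<and> card R = t \<and>
       M \<subseteq> {0..\<lfloor>(real q - 1) / real_of_int (set_rank R)\<rfloor>} \<and> set_solution_free R M \<and> 1 \<le> set_rank R"
    for q :: nat and R M :: "int set"
  \<comment> \<open>One parameter bounds both losses, so that a single diagonal argument treats them
    together.\<close>
  define Q where "Q e q \<longleftrightarrow> (\<exists>R M. G q R M \<and> real_of_int (set_rank R) \<le> real q powr e \<and>
      real (card M) \<ge> real q powr (1 - e))" for e q
  have "eventually (Q e) sequentially" if e: "0 < e" for e
  proof -
    \<comment> \<open>Strictly below \<open>e\<close>, so that \<open>c\<close> and the rank are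
      absorbed by the remaining power of \<open>q\<close>.\<close>
    define \<eta> where "\<eta> = min 1 (e / 2)"
    have \<eta>: "0 < \<eta>" "\<eta> \<le> 1" "\<eta> < e" using e by (auto simp: \<eta>_def)
    obtain R :: "int set" and c where c: "0 < c" and R: "finite R" "R \<subseteq> {0..}" "card R = t"
      and M: "\<And>N::nat. \<exists>M \<subseteq> {0..int N}. set_solution_free R M \<and> c * real (N + 1) powr (1 - \<eta>) \<le> real (card M)"
      using ex_fixed_set_dense_solution_free[of t \<eta>] assms \<eta> by auto
    define r where "r = real_of_int (set_rank R)"
    have "R \<noteq> {}" using R assms by auto
    have "Min R \<noteq> Max R"
    proof
      assume "Min R = Max R"
      then have "R \<subseteq> {Max R}" using R(1) Min_le Max_ge by (metis insertCI order_antisym subsetI)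
      then have "card R \<le> card {Max R}" by (intro card_mono) auto
      then show False using R(3) assms by simp
    qed
    moreover have "Min R \<le> Max R" using R(1) \<open>R \<noteq> {}\<close> by simp
    ultimately have rank: "1 \<le> set_rank R" by (simp add: set_rank_def)
    then have r: "1 \<le> r" by (simp add: r_def)
    have "eventually (\<lambda>q. real q powr e \<ge> r) sequentially"
      using e by real_asymp
    moreover have "eventually (\<lambda>q. c * ((real q - 1) / r) powr (1 - \<eta>) \<ge> real q powr (1 - e)) sequentially"
      using c r \<eta> by real_asymp
    moreover have "eventually (\<lambda>q. nat (Max R) + 1 \<le> q) sequentially" by (rule eventually_ge_at_top)
    ultimately show ?thesis
    proof eventually_elim
      case (elim q)
      define x where "x = (real q - 1) / r"
      have x: "0 \<le> x" using elim(3) r by (simp add: x_def)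
      \<comment> \<open>Rounding down costs nothing: the bound on \<open>M\<close> is in terms of
        \<open>N + 1\<close>, which is at least \<open>x\<close>.\<close>
      define N where "N = nat \<lfloor>x\<rfloor>"
      obtain M where M: "M \<subseteq> {0..int N}" "set_solution_free R M"
        "c * real (N + 1) powr (1 - \<eta>) \<le> real (card M)" using M by blast
      have N: "int N = \<lfloor>x\<rfloor>" using x by (simp add: N_def)
      then have "x \<le> real (N + 1)" by linarith
      then have "c * x powr (1 - \<eta>) \<le> c * real (N + 1) powr (1 - \<eta>)"
        using c x \<eta> by (intro mult_left_mono powr_mono2) auto
      then have "real q powr (1 - e) \<le> real (card M)" using M(3) elim(2) unfolding x_def by linarith
      moreover have "R \<subseteq> {0..int q - 1}"
      proof
        fix u assume "u \<in> R"
        then have "0 \<le> u" "u \<le> Max R" using R by auto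
        then show "u \<in> {0..int q - 1}" using elim(3) by simp
      qed
      ultimately have "G q R M" "real q powr (1 - e) \<le> real (card M)"
        using M R(3) N rank unfolding G_def x_def r_def by auto
      then show "Q e q" using elim(1) unfolding Q_def r_def by blast
    qed
  qed
  moreover have "Q e' q" if Q: "Q e q" and le: "e \<le> e'" "q \<ge> 1" for e e' q
  proof -
    have "real q powr e \<le> real q powr e'" "real q powr (1 - e') \<le> real q powr (1 - e)"
      using le by (auto intro!: powr_mono)
    then show ?thesis using Q unfolding Q_def by (meson order_trans)
  qed
  ultimately obtain \<delta> where \<delta>: "\<delta> \<longlonglongrightarrow> 0" and "eventually (\<lambda>q. Q (\<delta> q) q) sequentially"
    using eventually_diagonal[of Q] by blast
  then have "eventually (\<lambda>q. Q (\<delta> q) q \<and> q \<ge> 2) sequentially"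
    using eventually_ge_at_top[of 2] by (simp add: eventually_conj_iff)
  then obtain q0 where q0: "\<And>q. q \<ge> q0 \<Longrightarrow> Q (\<delta> q) q \<and> q \<ge> 2"
    unfolding eventually_sequentially by blast
  \<comment> \<open>The guard stands inside the quantifiers so that \<open>R\<close> and
    \<open>M\<close> can be chosen as functions of all \<open>q\<close>.\<close>
  then have "\<exists>R M. q \<ge> q0 \<longrightarrow> G q R M \<and> real_of_int (set_rank R) \<le> real q powr \<delta> q \<and>
      real (card M) \<ge> real q powr (1 - \<delta> q)" for q
    unfolding Q_def by blast
  then obtain R M where RM: "\<And>q. q \<ge> q0 \<Longrightarrow> G q (R q) (M q) \<and>
      real_of_int (set_rank (R q)) \<le> real q powr \<delta> q \<and> real (card (M q)) \<ge> real q powr (1 - \<delta> q)"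
    by metis
  \<comment> \<open>The rank has to equal a power of \<open>q\<close>, so the exponent is the exact
    logarithm; it is squeezed between 0 and \<open>\<delta>\<close>.\<close>
  define \<epsilon> where "\<epsilon> q = log (real q) (real_of_int (set_rank (R q)))" for q
  have \<epsilon>: "0 \<le> \<epsilon> q \<and> \<epsilon> q \<le> \<delta> q \<and> real_of_int (set_rank (R q)) = real q powr \<epsilon> q" if q: "q \<ge> q0" for q
  proof -
    have q2: "q \<ge> 2" using q0[OF q] by simp
    have r1: "1 \<le> real_of_int (set_rank (R q))" using RM[OF q] by (simp add: G_def)
    have eq: "real_of_int (set_rank (R q)) = real q powr \<epsilon> q" unfolding \<epsilon>_def using q2 r1 by simp
    have "real q powr \<epsilon> q \<le> real q powr \<delta> q" using RM[OF q] eq by simp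
    then have "\<epsilon> q \<le> \<delta> q" using q2 by (subst (asm) powr_le_cancel_iff) auto
    moreover have "0 \<le> \<epsilon> q" unfolding \<epsilon>_def using q2 r1 by simp
    ultimately show ?thesis using eq by blast
  qed
  have "\<epsilon> \<longlonglongrightarrow> 0"
  proof (rule tendsto_sandwich[OF _ _ tendsto_const \<delta>])
    show "eventually (\<lambda>q. 0 \<le> \<epsilon> q) sequentially" "eventually (\<lambda>q. \<epsilon> q \<le> \<delta> q) sequentially"
      using \<epsilon> unfolding eventually_sequentially by blast+
  qed
  then have "\<epsilon> \<in> o(\<lambda>_. 1)" by (intro smalloI_tendsto) auto
  moreover have "\<delta> \<in> o(\<lambda>_. 1)" using \<delta> by (intro smalloI_tendsto) auto
  moreover have "\<forall>q\<ge>q0. \<exists>R M :: int set.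
       R \<subseteq> {0..int q - 1} \<and> card R = t \<and>
       M \<subseteq> {0..\<lfloor>(real q - 1) / real_of_int (set_rank R)\<rfloor>} \<and>
       set_solution_free R M \<and>
       real_of_int (set_rank R) = real q powr \<epsilon> q \<and>
       real (card M) \<ge> real q powr (1 - \<delta> q)"
  proof (intro allI impI)
    fix q assume q: "q \<ge> q0"
    show "\<exists>R M :: int set.
       R \<subseteq> {0..int q - 1} \<and> card R = t \<and>
       M \<subseteq> {0..\<lfloor>(real q - 1) / real_of_int (set_rank R)\<rfloor>} \<and>
       set_solution_free R M \<and>
       real_of_int (set_rank R) = real q powr \<epsilon> q \<and>
       real (card M) \<ge> real q powr (1 - \<delta> q)"
      using RM[OF q] \<epsilon>[OF q] unfolding G_def by (intro exI[of _ "R q"] exI[of _ "M q"]) simp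
  qed
  ultimately show ?thesis by blast
qed

end
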